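(* Let $\alpha,\beta\in\mathbb{Q}$ be such that $p(x)=x^2+\alpha x+\beta$ is irreducible over $\mathbb{Q}$, let $A=\begin{bmatrix}0&-\beta\\1&-\alpha\end{bmatrix}$ be its companion matrix, and let $c\in\mathbb{Z}^+$ be such that $q(x)=cp(x)=cx^2+ax+b$ is a primitive polynomial with integer coefficients. Let $\mathcal{D}$, $\mathcal{N}$, $h$, $\Phi$, $T$ be as defined in the context. Then $T\circ h=h\circ\Phi$.
   Context: $\mathbb{Z}^2[A]=\bigcup_{k\ge0}(\mathbb{Z}^2+A\mathbb{Z}^2+\cdots+A^k\mathbb{Z}^2)$; $\mathbf{e}_1=(1,0)^\top$. $\mathcal{D}=\{(0,0)^\top,(1,0)^\top,\dots,(|b|-1,0)^\top\}$, a complete residue system of $\mathbb{Z}^2[A]/A\mathbb{Z}^2[A]$. The digit function $\mathrm{d}$ maps $x\in\mathbb{Z}^2[A]$ to the unique $\mathrm{d}(x)\in\mathcal{D}$ with $x-\mathrm{d}(x)\in A\mathbb{Z}^2[A]$, and $\Phi(x)=A^{-1}(x-\mathrm{d}(x))$. Let $\mathcal{R}=\mathbb{Z}[x]/q\mathbb{Z}[x]$, $X=x+q\mathbb{Z}[x]$, $\mathcal{N}=\{0,1,\dots,|b|-1\}\subseteq\mathcal{R}$ (a complete residue system of $\mathcal{R}/(X)$); $D_\mathcal{N}(r)$ is the unique element of $\mathcal{N}$ with $r-D_\mathcal{N}(r)\in(X)$, and $T:\mathcal{R}\to\mathcal{R}$ is $T(r)=(r-D_\mathcal{N}(r))/X$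 (the unique element $s$ with $Xs=r-D_\mathcal{N}(r)$). Every $v\in\mathbb{Z}^2[A]$ can be written uniquely as $v=\sum_{i=0}^{\ell}b_iA^i\mathbf{e}_1$ with $\ell\in\mathbb{N}$ minimal, $b_i\in\mathbb{Z}$, and $b_2,\dots,b_\ell\in\{0,1,\dots,c-1\}$ if $\ell\ge2$; the map $h:\mathbb{Z}^2[A]\to\mathcal{R}$ is defined by $h\big(\sum_{i=0}^\ell b_iA^i\mathbf{e}_1\big)=\sum_{i=0}^\ell b_iX^i$ using this representation (it is a $\mathbb{Z}$-module isomorphism). *)

theory Defs
  imports
    "HOL-Analysis.Cartesian_Space"
    "HOL-Algebra.QuotRing"
    "HOL-Algebra.Algebraic_Closure_Type"
begin

section \<open>The module \<open>\<int>\<^sup>2[A]\<close> and the backward division map\<close>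

text \<open>The operation \<open>*\<close> (and hence \<open>^\<close>) on \<^typ>\<open>rat^2^2\<close> is componentwise, so powers of a
  matrix have to be taken with respect to \<open>**\<close>.\<close>

definition matpow :: "rat^2^2 \<Rightarrow> nat \<Rightarrow> rat^2^2"
  where "matpow A i = (((**) A) ^^ i) (mat 1)"

definition e1 :: "rat^2"
  where "e1 = vector [1, 0]"

definition int_lattice :: "(rat^2) set"
  where "int_lattice = {v. \<forall>j. v $ j \<in> \<int>}"

definition lattice_adjoin :: "rat^2^2 \<Rightarrow> (rat^2) set"
  where "lattice_adjoin A =
    (\<Union>k::nat. {(\<Sum>i\<le>k. matpow A i *v z i) | z. \<forall>i\<le>k. z i \<in> int_lattice})"

definition digit_set :: "int \<Rightarrow> (rat^2) set"
  where "digit_set b = {vector [of_int k, 0] | k. 0 \<le> k \<and> k < \<bar>b\<bar>}"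

definition digit :: "rat^2^2 \<Rightarrow> int \<Rightarrow> rat^2 \<Rightarrow> rat^2"
  where "digit A b x = (THE d. d \<in> digit_set b \<and> x - d \<in> (*v) A ` lattice_adjoin A)"

definition Phi :: "rat^2^2 \<Rightarrow> int \<Rightarrow> rat^2 \<Rightarrow> rat^2"
  where "Phi A b x = matrix_inv A *v (x - digit A b x)"


section \<open>The quotient ring \<open>\<int>[x]/q\<int>[x]\<close> and its backward division map\<close>

text \<open>Elements of the quotient ring are cosets, that is, sets of integer polynomials.\<close>

abbreviation int_poly_ring :: "int poly ring"
  where "int_poly_ring \<equiv> ring_of_type_algebra"

definition quot_ring :: "int poly \<Rightarrow> int poly set ring"
  where "quot_ring q = int_poly_ring Quot (PIdl\<^bsub>int_poly_ring\<^esub> q)"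

definition quot_X :: "int poly \<Rightarrow> int poly set"
  where "quot_X q = (PIdl\<^bsub>int_poly_ring\<^esub> q) +>\<^bsub>int_poly_ring\<^esub> [:0, 1:]"

definition quot_digit_set :: "int poly \<Rightarrow> int \<Rightarrow> int poly set set"
  where "quot_digit_set q b =
    {[k] \<cdot>\<^bsub>quot_ring q\<^esub> \<one>\<^bsub>quot_ring q\<^esub> | k. 0 \<le> k \<and> k < \<bar>b\<bar>}"

definition quot_digit :: "int poly \<Rightarrow> int \<Rightarrow> int poly set \<Rightarrow> int poly set"
  where "quot_digit q b r = (THE n. n \<in> quot_digit_set q b \<and>
    r \<ominus>\<^bsub>quot_ring q\<^esub> n \<in> PIdl\<^bsub>quot_ring q\<^esub> (quot_X q))"

definition T_map :: "int poly \<Rightarrow> int \<Rightarrow> int poly set \<Rightarrow> int poly set"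
  where "T_map q b r = (THE s. s \<in> carrier (quot_ring q) \<and>
    quot_X q \<otimes>\<^bsub>quot_ring q\<^esub> s = r \<ominus>\<^bsub>quot_ring q\<^esub> quot_digit q b r)"


section \<open>The map \<open>h\<close>\<close>

text \<open>The list \<open>[b\<^sub>0, \<dots>, b\<^sub>l]\<close> encodes the representation \<open>v = (\<Sum>i\<le>l. b\<^sub>i A\<^sup>i e\<^sub>1)\<close>;
  being nonempty, it has length \<open>l + 1\<close>, so minimal \<open>l\<close> means minimal length.\<close>

definition is_expansion :: "rat^2^2 \<Rightarrow> int \<Rightarrow> rat^2 \<Rightarrow> int list \<Rightarrow> bool"
  where "is_expansion A c v bs \<longleftrightarrow>
    bs \<noteq> [] \<and>
    (\<forall>i. 2 \<le> i \<and> i < length bs \<longrightarrow> bs ! i \<in> {0..<c}) \<and>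
    v = (\<Sum>i<length bs. of_int (bs ! i) *s (matpow A i *v e1))"

definition expansion :: "rat^2^2 \<Rightarrow> int \<Rightarrow> rat^2 \<Rightarrow> int list"
  where "expansion A c v = (THE bs. is_expansion A c v bs \<and>
    (\<forall>bs'. is_expansion A c v bs' \<longrightarrow> length bs \<le> length bs'))"

definition h_map :: "rat^2^2 \<Rightarrow> int \<Rightarrow> int poly \<Rightarrow> rat^2 \<Rightarrow> int poly set"
  where "h_map A c q v =
    (\<Oplus>\<^bsub>quot_ring q\<^esub>i\<in>{..<length (expansion A c v)}.
       [expansion A c v ! i] \<cdot>\<^bsub>quot_ring q\<^esub> (quot_X q [^]\<^bsub>quot_ring q\<^esub> i))"

end

theory Submission
  imports Defs "HOL-Analysis.Determinants"
begin

text \<open>Let \<open>cyc A f = f(A) e\<^sub>1\<close>. Since \<open>q\<close> is primitive and \<open>e\<^sub>1, A e\<^sub>1\<close> are linearly independent, Gauss's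
  lemma shows that \<open>cyc A\<close> induces an isomorphism from \<open>\<int>[x]/q\<int>[x]\<close> onto \<open>\<int>\<^sup>2[A]\<close> which turns multiplication
  by \<open>X\<close> into multiplication by \<open>A\<close>; its inverse is \<open>h\<close>. Dividing by \<open>q\<close> from the top coefficient down
  to degree two gives the expansions in the definition of \<open>h\<close>. As \<open>b \<noteq> 0\<close>, every \<open>f\<close> satisfies
  \<open>f \<equiv> k + x g\<close> modulo \<open>q\<close> for a unique digit \<open>0 \<le> k < \<bar>b\<bar>\<close> and a \<open>g\<close> unique modulo \<open>q\<close>, and both
  backward division maps send the class of \<open>f\<close> to the class of \<open>g\<close>.\<close>

section \<open>Evaluation of integer polynomials at \<open>A\<close> on \<open>e1\<close>\<close>

definition cyc :: "rat^2^2 \<Rightarrow> int poly \<Rightarrow> rat^2"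
  where "cyc A f = fold_coeffs (\<lambda>k v. of_int k *s e1 + A *v v) f 0"

lemma cyc_0 [simp]: "cyc A 0 = 0"
  by (simp add: cyc_def)

lemma cyc_pCons [simp]: "cyc A (pCons k f) = of_int k *s e1 + A *v cyc A f"
  \<comment> \<open>\<open>fold_coeffs\<close> unfolds at \<open>pCons k f\<close> except when this
    is the zero polynomial; there both sides vanish.\<close>
  by (cases "k = 0 \<and> f = 0") (auto simp: cyc_def matrix_vector_mult_0_right)

lemma cyc_add: "cyc A (f + g) = cyc A f + cyc A g"
  by (induction f g rule: poly_induct2)
    (simp_all add: matrix_vector_right_distrib vector_sadd_rdistrib algebra_simps)

lemma cyc_smult: "cyc A (smult k f) = of_int k *s cyc A f"
  by (induction f)
    (simp_all add: matrix_vector_right_distrib vector_scalar_commute vector_smult_assoc vector_add_ldistrib)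

lemma cyc_uminus: "cyc A (- f) = - cyc A f"
  using cyc_smult[of A "-1" f] by simp

lemma cyc_diff: "cyc A (f - g) = cyc A f - cyc A g"
  using cyc_add[of A f "-g"] by (simp add: cyc_uminus)

lemma matpow_Suc: "matpow A (Suc i) *v v = A *v (matpow A i *v v)"
  by (simp add: matpow_def matrix_vector_mul_assoc)

lemma matpow_0 [simp]: "matpow A 0 *v v = v"
  by (simp add: matpow_def)

lemma cyc_Poly:
  "cyc A (Poly bs) = (\<Sum>i<length bs. of_int (bs ! i) *s (matpow A i *v e1))"
proof (induction bs)
  case (Cons k bs)
  have "A *v (\<Sum>i<length bs. of_int (bs ! i) *s (matpow A i *v e1))
      = (\<Sum>i<length bs. of_int (bs ! i) *s (matpow A (Suc i) *v e1))"
    by (simp add: vec.linear_sum[OF matrix_vector_mul_linear_gen] matpow_Suc vector_scalar_commute)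
  then show ?case
    using Cons by (simp add: sum.lessThan_Suc_shift del: sum.lessThan_Suc)
qed simp

lemma is_expansion_iff:
  "is_expansion A c v bs \<longleftrightarrow>
    bs \<noteq> [] \<and> (\<forall>i. 2 \<le> i \<and> i < length bs \<longrightarrow> bs ! i \<in> {0..<c}) \<and> v = cyc A (Poly bs)"
  by (simp add: is_expansion_def cyc_Poly)

text \<open>\<open>Poly\<close> drops trailing zeros, so a list is recovered from its polynomial
  only once its length is known. For expansions, minimality fixes the length.\<close>

lemma Poly_eq_imp_eq:
  assumes "Poly xs = Poly ys" "length xs = length ys"
  shows "xs = ys"
  using assms(2,1) by (induction xs ys rule: list_induct2) auto

lemma degree_less_2E:
  assumes "degree f < 2"
  obtains u w where "f = [:u, w:]"
proof -
  obtain u g where f: "f = pCons u g" by (cases f)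
  with assms have "degree g = 0"
    by (cases "g = 0") auto
  then show ?thesis
    using that f by (auto elim: degree_eq_zeroE)
qed

text \<open>Gauss's lemma: contents multiply, so \<open>m\<close> divides the content of the
  cofactor of \<open>q\<close> and can be cancelled.\<close>

lemma primitive_dvd_smultD:
  fixes q f :: "int poly"
  assumes "content q = 1" "q dvd smult m f" "m \<noteq> 0"
  shows "q dvd f"
proof -
  obtain g where g: "smult m f = q * g"
    using assms(2) by (auto elim: dvdE)
  have "content g = normalize m * content f"
    using arg_cong[OF g, of content] assms(1) by (simp add: content_mult)
  then have "[:m:] dvd g"
    by (simp add: const_poly_dvd_iff_dvd_content)
  then obtain g' where "g = smult m g'"
    by (auto elim: dvdE)
  with g assms(3) have "f = q * g'"
    by (metis mult_smult_right smult_cancel)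
  then show ?thesis by simp
qed

text \<open>Irreducibility of \<open>p\<close> is recorded as \<open>b_nonzero\<close>, which makes
  \<open>A\<close> invertible and \<open>x\<close> cancellable modulo \<open>q\<close>.\<close>

locale companion =
  fixes \<alpha> \<beta> :: rat and a b c :: int and q :: "int poly" and A :: "rat^2^2"
  assumes A_eq: "A = vector [vector [0, -\<beta>], vector [1, -\<alpha>]]"
    and c_pos: "c > 0"
    and q_eq: "q = [:b, a, c:]"
    and b_eq: "of_int b = of_int c * \<beta>"
    and a_eq: "of_int a = of_int c * \<alpha>"
    and primitive: "content q = 1"
    and b_nonzero: "b \<noteq> 0"
begin

lemma A_nth [simp]: "(A *v x) $ 1 = - \<beta> * x $ 2" "(A *v x) $ 2 = x $ 1 - \<alpha> * x $ 2"
  by (simp_all add: A_eq matrix_vector_mult_def sum_2)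

lemma e1_nth [simp]: "e1 $ 1 = 1" "e1 $ 2 = 0"
  by (simp_all add: e1_def)

lemma beta_nonzero: "\<beta> \<noteq> 0"
  using b_eq b_nonzero by auto

lemma matrix_inv_A: "matrix_inv A *v (A *v x) = x"
proof -
  have "det A = \<beta>"
    by (simp add: A_eq det_2)
  then have "invertible A"
    using beta_nonzero by (simp add: invertible_det_nz)
  then have "matrix_inv A ** A = mat 1"
    unfolding invertible_def matrix_inv_def by (rule someI2_ex) simp
  then show ?thesis
    by (simp add: matrix_vector_mul_assoc)
qed

section \<open>Kernel and image of \<open>cyc A\<close>\<close>

lemma q_nonzero: "q \<noteq> 0" and degree_q: "degree q = 2"
  using c_pos by (auto simp: q_eq)

lemma cyc_q: "cyc A q = 0"
  by (simp add: q_eq vec_eq_iff forall_2 a_eq b_eq)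

lemma cyc_q_mult: "cyc A (q * g) = 0"
  by (induction g) (simp_all add: cyc_add cyc_smult cyc_q)

text \<open>Pseudo-division by \<open>q\<close> leaves a remainder \<open>[:u, w:]\<close>, whose
  image is the vector (u, w) because A e1 = (0, 1). So the remainder vanishes, and primitivity
  removes the factor \<open>m\<close> that pseudo-division introduced.\<close>

lemma cyc_eq_0_iff: "cyc A f = 0 \<longleftrightarrow> q dvd f"
proof
  assume f: "cyc A f = 0"
  define r where "r = pseudo_mod f q"
  obtain m g where m: "m \<noteq> 0" and g: "smult m f = q * g + r"
    using pseudo_mod(1)[OF q_nonzero, of f] by (auto simp: r_def)
  have "r = 0 \<or> degree r < 2"
    using pseudo_mod(2)[OF q_nonzero, of f] by (simp add: r_def degree_q)
  then have "degree r < 2" by auto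
  then obtain u w where r: "r = [:u, w:]"
    by (rule degree_less_2E)
  have "cyc A r = 0"
    using arg_cong[OF g, of "cyc A"] f by (simp add: cyc_add cyc_smult cyc_q_mult)
  then have "r = 0"
    by (simp add: r vec_eq_iff forall_2)
  with g have "q dvd smult m f" by simp
  then show "q dvd f"
    using primitive_dvd_smultD[OF primitive] m by blast
qed (auto simp: cyc_q_mult elim!: dvdE)

lemma cyc_eq_iff: "cyc A f = cyc A g \<longleftrightarrow> q dvd f - g"
  by (simp add: cyc_diff flip: cyc_eq_0_iff)

text \<open>Lattice vectors are the images of polynomials of degree at most one, and the range is
  closed under \<open>A\<close> and addition. Conversely, the coefficients of a polynomial times
  \<open>e1\<close> are lattice vectors.\<close>

lemma lattice_adjoin_eq_range: "lattice_adjoin A = range (cyc A)"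
proof (intro equalityI subsetI)
  have matpow_closed: "matpow A i *v cyc A f \<in> range (cyc A)" for i f
  proof (induction i)
    case (Suc i)
    then obtain g where "matpow A i *v cyc A f = cyc A g" by auto
    then have "matpow A (Suc i) *v cyc A f = cyc A (pCons 0 g)"
      by (simp add: matpow_Suc)
    then show ?case by blast
  qed simp
  have add: "x + y \<in> range (cyc A)" if "x \<in> range (cyc A)" "y \<in> range (cyc A)" for x y
    using that by (auto simp flip: cyc_add)
  have zero: "0 \<in> range (cyc A)"
    using cyc_0 by (metis rangeI)
  fix v assume "v \<in> lattice_adjoin A"
  then obtain k z where v: "v = (\<Sum>i\<le>k. matpow A i *v z i)" and z: "\<forall>i\<le>k. z i \<in> int_lattice"
    by (auto simp: lattice_adjoin_def)
  have "matpow A i *v z i \<in> range (cyc A)" if "i \<le> k" for i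
  proof -
    have "z i $ 1 \<in> \<int>" "z i $ 2 \<in> \<int>"
      using z that by (auto simp: int_lattice_def)
    then obtain u w where "z i $ 1 = of_int u" "z i $ 2 = of_int w"
      by (elim Ints_cases)
    then have "z i = cyc A [:u, w:]"
      by (simp add: vec_eq_iff forall_2)
    then show ?thesis using matpow_closed by metis
  qed
  then show "v \<in> range (cyc A)"
    unfolding v by (induction k) (auto intro: add)
next
  fix v assume "v \<in> range (cyc A)"
  then obtain f where v: "v = cyc A f" by auto
  \<comment> \<open>The extra zero makes the index range \<open>i < length bs\<close> equal to
    \<open>i \<le> length (coeffs f)\<close>, also for f = 0.\<close>
  define bs where "bs = coeffs f @ [0]"
  define z :: "nat \<Rightarrow> rat^2" where "z i = of_int (bs ! i) *s e1" for i
  have "v = (\<Sum>i<length bs. of_int (bs ! i) *s (matpow A i *v e1))"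
    by (simp add: v flip: cyc_Poly) (simp add: bs_def Poly_snoc)
  also have "\<dots> = (\<Sum>i\<le>length (coeffs f). matpow A i *v z i)"
    by (rule sum.cong) (auto simp: bs_def z_def vector_scalar_commute)
  finally show "v \<in> lattice_adjoin A"
    unfolding lattice_adjoin_def
    by (force simp: z_def int_lattice_def forall_2)
qed

section \<open>Backward division of polynomials modulo \<open>q\<close>\<close>

lemma ex_shift:
  "\<exists>k g. 0 \<le> k \<and> k < \<bar>b\<bar> \<and> q dvd f - [:k:] - pCons 0 g"
proof -
  obtain u f' where f: "f = pCons u f'" by (cases f)
  \<comment> \<open>The sign turns division by the absolute value of \<open>b\<close> into u = k + b
    m. Subtracting m q then replaces b m in the constant term by the carry -m (a + c x) in the
    quotient.\<close>
  define k m where "k = u mod \<bar>b\<bar>" and "m = sgn b * (u div \<bar>b\<bar>)"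
  have "b * m = \<bar>b\<bar> * (u div \<bar>b\<bar>)"
    by (simp add: m_def abs_sgn mult.assoc)
  then have "u = k + b * m"
    by (simp add: k_def)
  then have "f - [:k:] - pCons 0 (f' - smult m [:a, c:]) = smult m q"
    by (simp add: f q_eq)
  moreover have "0 \<le> k" "k < \<bar>b\<bar>"
    using b_nonzero by (simp_all add: k_def)
  ultimately show ?thesis
    by (intro exI[of _ k] exI[of _ "f' - smult m [:a, c:]"]) (simp add: dvd_smult)
qed

lemma shift_unique:
  assumes "0 \<le> k" "k < \<bar>b\<bar>" "q dvd f - [:k:] - pCons 0 g"
    and "0 \<le> k'" "k' < \<bar>b\<bar>" "q dvd f - [:k':] - pCons 0 g'"
  shows "k = k'"
proof -
  have "q dvd (f - [:k:] - pCons 0 g) - (f - [:k':] - pCons 0 g')"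
    using assms(3,6) by (rule dvd_diff)
  then obtain w where "pCons (k' - k) (g' - g) = q * w"
    by (auto elim!: dvdE)
  \<comment> \<open>Evaluation at 0 reads off constant terms, and that of \<open>q\<close> is
    \<open>b\<close>.\<close>
  from arg_cong[OF this, of "\<lambda>f. poly f 0"] have "b dvd k' - k"
    by (simp add: q_eq)
  moreover have "\<bar>k' - k\<bar> < \<bar>b\<bar>"
    using assms by linarith
  ultimately show ?thesis
    using dvd_imp_le_int[of "k' - k" b] by fastforce
qed

text \<open>Since \<open>q\<close> has nonzero constant term, \<open>x\<close> is not a zero divisor
  modulo \<open>q\<close>. This makes the quotient in \<open>T_map\<close> unique.\<close>

lemma dvd_pCons_0D:
  assumes "q dvd pCons 0 g"
  shows "q dvd g"
proof -
  obtain w where w: "pCons 0 g = q * w"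
    using assms by (auto elim: dvdE)
  obtain u w' where w': "w = pCons u w'" by (cases w)
  have "u = 0"
    using arg_cong[OF w, of "\<lambda>f. poly f 0"] b_nonzero by (simp add: q_eq w')
  then have "g = q * w'"
    using w by (simp add: w')
  then show ?thesis by simp
qed

text \<open>The kernel of \<open>cyc A\<close> turns the condition defining \<open>digit\<close>
  into the divisibility by \<open>q\<close> from \<open>ex_shift\<close>, and
  \<open>shift_unique\<close> then identifies the digit.\<close>

lemma Phi_cyc:
  assumes "0 \<le> k" "k < \<bar>b\<bar>" "q dvd f - [:k:] - pCons 0 g"
  shows "Phi A b (cyc A f) = cyc A g"
proof -
  have const: "vector [of_int l, 0] = cyc A [:l:]" for l
    by (simp add: vec_eq_iff forall_2)
  have char: "cyc A f - cyc A [:l:] = A *v cyc A g' \<longleftrightarrow> q dvd f - [:l:] - pCons 0 g'" for l g'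
    using cyc_eq_iff[of "f - [:l:]" "pCons 0 g'"] by (simp add: cyc_diff)
  have "digit A b (cyc A f) = cyc A [:k:]"
    unfolding digit_def digit_set_def lattice_adjoin_eq_range const
  proof (rule the_equality)
    show "cyc A [:k:] \<in> {cyc A [:k:] |k. 0 \<le> k \<and> k < \<bar>b\<bar>} \<and>
        cyc A f - cyc A [:k:] \<in> (*v) A ` range (cyc A)"
      using char[of k g] assms by blast
  next
    fix d
    assume "d \<in> {cyc A [:k:] |k. 0 \<le> k \<and> k < \<bar>b\<bar>} \<and> cyc A f - d \<in> (*v) A ` range (cyc A)"
    then obtain l g' where l: "d = cyc A [:l:]" "0 \<le> l" "l < \<bar>b\<bar>"
      and "cyc A f - cyc A [:l:] = A *v cyc A g'"
      by blast
    then have "q dvd f - [:l:] - pCons 0 g'"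
      using char by blast
    then show "d = cyc A [:k:]"
      using shift_unique[OF assms] l by blast
  qed
  then show ?thesis
    using char[of k g] assms(3) by (simp add: Phi_def matrix_inv_A del: cyc_pCons)
qed

section \<open>Existence and uniqueness of expansions\<close>

lemma ex_reduced_list:
  "\<exists>bs. length bs = n + 2 \<and> (\<forall>i. 2 \<le> i \<and> i < length bs \<longrightarrow> bs ! i \<in> {0..<c}) \<and>
    q dvd f - Poly bs" if "degree f < n + 2"
  using that
proof (induction n arbitrary: f)
  case 0
  then obtain u w where "f = [:u, w:]"
    using degree_less_2E[of f] by auto
  then show ?case
    by (intro exI[of _ "[u, w]"]) simp
next
  case (Suc n)
  \<comment> \<open>Subtracting m x^n q reduces the coefficient of x^(n+2) modulo \<open>c\<close>.
    The residue \<open>r\<close> becomes the last digit, and the induction continues with the lower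
    coefficients.\<close>
  define m where "m = coeff f (n + 2) div c"
  define r where "r = coeff f (n + 2) mod c"
  define f' where "f' = f - monom m n * q - monom r (n + 2)"
  have top: "coeff (monom m n * q) (n + 2) = m * c"
    by (simp add: coeff_monom_mult q_eq numeral_2_eq_2)
  have "coeff f' i = 0" if "i > n + 1" for i
  proof (cases "i = n + 2")
    case True
    then show ?thesis
      unfolding f'_def coeff_diff True top by (simp add: m_def r_def minus_div_mult_eq_mod)
  next
    case False
    with that have "i > n + 2" by simp
    moreover have "degree (monom m n * q) \<le> n + 2"
      using degree_mult_le[of "monom m n" q] degree_monom_le[of m n] by (simp add: degree_q)
    ultimately have "coeff f i = 0" "coeff (monom m n * q) i = 0"
      using Suc.prems by (auto intro!: coeff_eq_0)
    then show ?thesis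
      using \<open>i > n + 2\<close> by (simp add: f'_def)
  qed
  then have "degree f' \<le> n + 1"
    by (intro degree_le) auto
  then obtain bs where bs: "length bs = n + 2" "\<forall>i. 2 \<le> i \<and> i < length bs \<longrightarrow> bs ! i \<in> {0..<c}"
      "q dvd f' - Poly bs"
    using Suc.IH[of f'] by auto
  have "f - Poly (bs @ [r]) = (f' - Poly bs) + q * monom m n"
    by (simp add: f'_def Poly_append bs(1) monom_altdef algebra_simps)
  then have "q dvd f - Poly (bs @ [r])"
    using bs(3) by simp
  moreover have "r \<in> {0..<c}"
    using c_pos by (simp add: r_def)
  ultimately show ?case
    using bs by (intro exI[of _ "bs @ [r]"]) (auto simp: nth_append)
qed

text \<open>A nonzero difference would be a multiple of \<open>q\<close>, hence of degree at least 2
  with leading coefficient divisible by \<open>c\<close>; but there it is a difference of two digits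
  in \<open>{0..<c}\<close>.\<close>

lemma expansion_Poly_unique:
  assumes "is_expansion A c v xs" "is_expansion A c v ys"
  shows "Poly xs = Poly ys"
proof (rule ccontr)
  let ?d = "Poly xs - Poly ys"
  assume "Poly xs \<noteq> Poly ys"
  then have nz: "?d \<noteq> 0" by simp
  have "q dvd ?d"
    using assms by (simp add: is_expansion_iff flip: cyc_eq_iff)
  then obtain w where w: "?d = q * w" by (auto elim: dvdE)
  with nz have "w \<noteq> 0" by auto
  then have "degree ?d \<ge> 2"
    using q_nonzero by (simp add: w degree_mult_eq degree_q)
  \<comment> \<open>Past the end of a list the coefficient is 0, which also lies in
    \<open>{0..<c}\<close>.\<close>
  then have "coeff (Poly xs) (degree ?d) \<in> {0..<c}" "coeff (Poly ys) (degree ?d) \<in> {0..<c}"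
    using assms c_pos by (auto simp: is_expansion_iff nth_default_def)
  then have "\<bar>lead_coeff ?d\<bar> < c" by auto
  moreover have "c dvd lead_coeff ?d"
    using c_pos unfolding w lead_coeff_mult by (simp add: q_eq)
  ultimately have "lead_coeff ?d = 0"
    by (metis abs_of_pos c_pos dvd_imp_le_int not_le)
  with nz show False
    by (simp only: leading_coeff_0_iff)
qed

text \<open>Justifies the description in \<open>expansion\<close>: a shortest expansion exists by
  well-ordering, and two shortest ones have equal polynomials and lengths.\<close>

lemma expansion_props:
  assumes "v \<in> range (cyc A)"
  shows "is_expansion A c v (expansion A c v)"
proof -
  let ?P = "\<lambda>n. \<exists>bs. is_expansion A c v bs \<and> length bs = n"
  obtain f where v: "v = cyc A f" using assms by auto
  obtain bs where "length bs = degree f + 2" "\<forall>i. 2 \<le> i \<and> i < length bs \<longrightarrow> bs ! i \<in> {0..<c}"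
      "q dvd f - Poly bs"
    using ex_reduced_list[of f "degree f"] by auto
  then have "?P (degree f + 2)"
    unfolding is_expansion_iff v cyc_eq_iff by (intro exI[of _ bs]) auto
  then have "?P (LEAST n. ?P n)" by (rule LeastI)
  then obtain xs where xs: "is_expansion A c v xs" "length xs = (LEAST n. ?P n)" by blast
  have min: "length xs \<le> length ys" if "is_expansion A c v ys" for ys
    unfolding xs(2) using that by (blast intro: Least_le)
  have "expansion A c v = xs"
    unfolding expansion_def
  proof (rule the_equality)
    fix ys
    assume "is_expansion A c v ys \<and> (\<forall>bs'. is_expansion A c v bs' \<longrightarrow> length ys \<le> length bs')"
    then show "ys = xs"
      using xs(1) min by (intro Poly_eq_imp_eq expansion_Poly_unique[of v]) (auto intro: antisym)
  qed (use xs min in auto)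
  with xs show ?thesis by simp
qed

section \<open>The quotient ring and the maps \<open>h\<close> and \<open>T\<close>\<close>

abbreviation "R \<equiv> int_poly_ring"
abbreviation "Q \<equiv> quot_ring q"
abbreviation "I \<equiv> PIdl\<^bsub>R\<^esub> q"

abbreviation proj :: "int poly \<Rightarrow> int poly set"
  where "proj \<equiv> (+>\<^bsub>R\<^esub>) I"

sublocale R: cring R
  by (rule cring_from_type_algebra)

lemma R_simps [simp]:
  "carrier R = UNIV" "x \<otimes>\<^bsub>R\<^esub> y = x * y" "x \<oplus>\<^bsub>R\<^esub> y = x + y" "\<one>\<^bsub>R\<^esub> = 1" "\<zero>\<^bsub>R\<^esub> = 0"
  by (simp_all add: ring_of_type_algebra_def)

lemma R_uminus [simp]: "\<ominus>\<^bsub>R\<^esub> x = - x"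
  by (rule R.minus_equality) simp_all

lemma R_minus [simp]: "x \<ominus>\<^bsub>R\<^esub> y = x - y"
  by (simp add: R.minus_eq)

lemma ideal_I: "ideal I R"
  by (rule R.cgenideal_ideal) simp

lemma mem_I_iff: "f \<in> I \<longleftrightarrow> q dvd f"
  by (auto simp: cgenideal_def dvd_def mult.commute)

sublocale proj: ring_hom_cring R Q proj
  unfolding quot_ring_def
  by (rule ideal.rcos_ring_hom_cring[OF ideal_I]) (rule R.is_cring)

lemma proj_eq_iff: "proj f = proj g \<longleftrightarrow> q dvd f - g"
  using R.quotient_eq_iff_same_a_r_cos[OF ideal_I, of f g] by (simp add: mem_I_iff)

lemma carrier_Q: "carrier Q = range proj"
  by (auto simp: quot_ring_def FactRing_def A_RCOSETS_def')


lemma quot_X_eq: "quot_X q = proj [:0, 1:]"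
  by (simp add: quot_X_def)

lemma R_add_pow [simp]: "[k] \<cdot>\<^bsub>R\<^esub> f = of_int k * f" for k :: int
proof -
  have nat: "[n] \<cdot>\<^bsub>R\<^esub> f = of_nat n * f" for n :: nat
    by (induction n) (simp_all add: algebra_simps)
  show ?thesis
    by (cases "k < 0") (simp_all add: add_pow_int_lt add_pow_int_ge nat)
qed

lemma R_pow [simp]: "f [^]\<^bsub>R\<^esub> n = f ^ n" for n :: nat
  by (induction n) (simp_all add: mult.commute)

lemma R_finsum: "finite S \<Longrightarrow> finsum R g S = sum g S"
  by (induction S rule: finite_induct) (simp_all add: R.finsum_insert)

lemma proj_add_pow: "[k] \<cdot>\<^bsub>Q\<^esub> proj f = proj (of_int k * f)" for k :: int
proof -
  \<comment> \<open>Integer multiples are powers in the additive group, so a homomorphism of these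
    groups preserves them.\<close>
  have "proj \<in> hom (add_monoid R) (add_monoid Q)"
    using proj.hom_add by (auto simp: hom_def)
  then have "proj ([k] \<cdot>\<^bsub>R\<^esub> f) = [k] \<cdot>\<^bsub>Q\<^esub> proj f"
    unfolding add_pow_def by (rule hom_int_pow[OF _ _ R.a_group proj.S.a_group]) simp
  then show ?thesis by simp
qed

lemma proj_diff: "proj f \<ominus>\<^bsub>Q\<^esub> proj g = proj (f - g)"
  using proj.hom_add[of f "- g"] proj.hom_a_inv[of g] by (simp add: proj.S.minus_eq)

lemma proj_mult: "proj f \<otimes>\<^bsub>Q\<^esub> proj g = proj (f * g)"
  using proj.hom_mult[of f g] by simp

lemma Poly_eq_sum: "Poly bs = (\<Sum>i<length bs. of_int (bs ! i) * [:0, 1:] ^ i)"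
proof (induction bs)
  case (Cons k bs)
  have "Poly (k # bs) = of_int k + [:0, 1:] * Poly bs"
    by (simp add: of_int_poly)
  also have "\<dots> = (\<Sum>i<length (k # bs). of_int ((k # bs) ! i) * [:0, 1:] ^ i)"
    unfolding Cons by (simp add: sum.lessThan_Suc_shift sum_distrib_left mult_ac del: sum.lessThan_Suc)
  finally show ?case .
qed simp

text \<open>The expansion is the coefficient list of a polynomial congruent to \<open>f\<close>
  modulo \<open>q\<close>, so \<open>h\<close> inverts the isomorphism induced by
  \<open>cyc A\<close>.\<close>

lemma h_map_cyc: "h_map A c q (cyc A f) = proj f"
proof -
  define bs where "bs = expansion A c (cyc A f)"
  have "cyc A f = cyc A (Poly bs)"
    using expansion_props[of "cyc A f"] by (simp add: bs_def is_expansion_iff)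
  then have "proj f = proj (Poly bs)"
    by (simp add: cyc_eq_iff proj_eq_iff)
  also have "\<dots> = proj (finsum R (\<lambda>i. of_int (bs ! i) * [:0, 1:] ^ i) {..<length bs})"
    by (simp add: R_finsum Poly_eq_sum)
  also have "\<dots> = (\<Oplus>\<^bsub>Q\<^esub>i\<in>{..<length bs}. proj (of_int (bs ! i) * [:0, 1:] ^ i))"
    by (subst proj.hom_finsum) (simp_all add: o_def)
  also have "\<dots> = (\<Oplus>\<^bsub>Q\<^esub>i\<in>{..<length bs}. [bs ! i] \<cdot>\<^bsub>Q\<^esub> (quot_X q [^]\<^bsub>Q\<^esub> i))"
    by (simp add: quot_X_eq proj_add_pow flip: proj.hom_pow)
  finally show ?thesis
    by (simp add: h_map_def bs_def)
qed

text \<open>Parallel to \<open>Phi_cyc\<close>, with \<open>proj\<close> for \<open>cyc A\<close>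
  and multiplication by \<open>quot_X q\<close> for \<open>A\<close>; both maps identify polynomials
  exactly modulo \<open>q\<close>.\<close>

lemma T_map_proj:
  assumes "0 \<le> k" "k < \<bar>b\<bar>" "q dvd f - [:k:] - pCons 0 g"
  shows "T_map q b (proj f) = proj g"
proof -
  have const: "[l] \<cdot>\<^bsub>Q\<^esub> \<one>\<^bsub>Q\<^esub> = proj [:l:]" for l
    using proj_add_pow[of l 1] proj.hom_one by (simp add: of_int_poly)
  have char: "quot_X q \<otimes>\<^bsub>Q\<^esub> proj g' = proj f \<ominus>\<^bsub>Q\<^esub> proj [:l:]
      \<longleftrightarrow> q dvd f - [:l:] - pCons 0 g'" for l g'
    using proj_eq_iff[of "f - [:l:]" "pCons 0 g'"]
    by (auto simp: quot_X_eq proj_mult proj_diff)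
  have ideal: "PIdl\<^bsub>Q\<^esub> (quot_X q) = {quot_X q \<otimes>\<^bsub>Q\<^esub> proj g' | g'. True}"
  proof -
    have "PIdl\<^bsub>Q\<^esub> (quot_X q) = (\<lambda>s. s \<otimes>\<^bsub>Q\<^esub> quot_X q) ` carrier Q"
      by (auto simp: cgenideal_def[of Q])
    then show ?thesis
      unfolding carrier_Q image_image by (auto simp: quot_X_eq proj_mult)
  qed
  have "quot_digit q b (proj f) = proj [:k:]"
    unfolding quot_digit_def quot_digit_set_def ideal const
  proof (rule the_equality)
    show "proj [:k:] \<in> {proj [:k:] | k. 0 \<le> k \<and> k < \<bar>b\<bar>} \<and>
        proj f \<ominus>\<^bsub>Q\<^esub> proj [:k:] \<in> {quot_X q \<otimes>\<^bsub>Q\<^esub> proj g' | g'. True}"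
      using char[of g k] assms by (metis (mono_tags, lifting) mem_Collect_eq)
  next
    fix d
    assume "d \<in> {proj [:k:] | k. 0 \<le> k \<and> k < \<bar>b\<bar>} \<and>
        proj f \<ominus>\<^bsub>Q\<^esub> d \<in> {quot_X q \<otimes>\<^bsub>Q\<^esub> proj g' | g'. True}"
    then obtain l g' where l: "d = proj [:l:]" "0 \<le> l" "l < \<bar>b\<bar>"
      and "quot_X q \<otimes>\<^bsub>Q\<^esub> proj g' = proj f \<ominus>\<^bsub>Q\<^esub> proj [:l:]"
      by auto
    then have "q dvd f - [:l:] - pCons 0 g'"
      using char by blast
    then show "d = proj [:k:]"
      using shift_unique[OF assms] l by blast
  qed
  then show ?thesis
    unfolding T_map_def
  proof (intro the_equality, goal_cases)
    case 1
    then show ?case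
      using char[of g k] assms by (simp add: carrier_Q)
  next
    case (2 s)
    then obtain g' where g': "s = proj g'" "q dvd f - [:k:] - pCons 0 g'"
      using char by (auto simp: carrier_Q)
    \<comment> \<open>Two candidate quotients differ by a class killed by \<open>x\<close>, hence by
      zero.\<close>
    have "q dvd (f - [:k:] - pCons 0 g) - (f - [:k:] - pCons 0 g')"
      using assms(3) g'(2) by (rule dvd_diff)
    then have "q dvd pCons 0 (g' - g)" by simp
    then show ?case
      using dvd_pCons_0D g'(1) by (simp add: proj_eq_iff)
  qed
qed

lemma T_map_h_map:
  assumes "v \<in> lattice_adjoin A"
  shows "T_map q b (h_map A c q v) = h_map A c q (Phi A b v)"
proof -
  obtain f where v: "v = cyc A f"
    using assms by (auto simp: lattice_adjoin_eq_range)
  obtain k g where "0 \<le> k" "k < \<bar>b\<bar>" "q dvd f - [:k:] - pCons 0 g"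
    using ex_shift by blast
  then show ?thesis
    by (simp add: v h_map_cyc Phi_cyc T_map_proj)
qed

end

theorem theorem8p3:
  fixes \<alpha> \<beta> :: rat and a b c :: int
    and p :: "rat poly" and q :: "int poly" and A :: "rat^2^2"
  assumes "p = [:\<beta>, \<alpha>, 1:]"
    and "Factorial_Ring.irreducible p"
    and "A = vector [vector [0, -\<beta>], vector [1, -\<alpha>]]"
    and "c > 0"
    and "q = [:b, a, c:]"
    and "map_poly rat_of_int q = smult (rat_of_int c) p"
    and "content q = 1"
  shows "\<forall>v \<in> lattice_adjoin A.
    (T_map q b \<circ> h_map A c q) v = (h_map A c q \<circ> Phi A b) v"
proof -
  have coeffs: "of_int b = of_int c * \<beta>" "of_int a = of_int c * \<alpha>"
    using assms(6) \<open>c > 0\<close> by (simp_all add: assms(1,5) map_poly_pCons)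
  have "b \<noteq> 0"
  proof
    assume "b = 0"
    with coeffs(1) \<open>c > 0\<close> have "\<beta> = 0" by simp
    \<comment> \<open>With b = 0 the polynomial \<open>p\<close> splits into two linear factors,
      neither of them a unit.\<close>
    then have "p = [:0, 1:] * [:\<alpha>, 1:]"
      by (simp add: assms(1))
    then have "is_unit [:0, 1 :: rat:] \<or> is_unit [:\<alpha>, 1:]"
      using assms(2) by (blast dest: irreducibleD)
    then show False
      by (auto simp: is_unit_poly_iff)
  qed
  then interpret companion \<alpha> \<beta> a b c q A
    using assms coeffs by unfold_locales auto
  show ?thesis
    by (simp add: T_map_h_map)
qed

end
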